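(* Let $\mathcal{C}$ be the set of integer partitions in which the difference of any two consecutive (adjacent) parts is at least $2$, and is exactly $2$ or $3$ only if the sum of these two parts is a multiple of $3$. Let $\mathcal{P}_1$ be the set of $\pi\in\mathcal{C}$ in which $1$ does not appear as a part, and let $\mathcal{P}_2$ be the set of $\pi\in\mathcal{C}$ in which $2$ does not appear as a part. Then, as formal power series in $x,q$, $$\sum_{\pi\in\mathcal{P}_1}x^{\ell(\pi)}q^{|\pi|}=\sum_{i,j\ge 0}\frac{x^{i+2j}q^{2i^2+6ij+6j^2}}{(q;q)_i\,(q^3;q^3)_j},$$ and, writing $R=i+j+k+2l$ in the four-fold sum, $$\sum_{\pi\in\mathcal{P}_2}x^{\ell(\pi)}q^{|\pi|}=\sum_{i,j,k,l\ge 0}\frac{x^{R}q^{\frac{3R(R-1)}{2}+3i+5j+\frac{3j(j-1)}{2}+k+\frac{3k(k-1)}{2}+3l}}{(q^3;q^3)_i\,(q^3;q^3)_j\,(q^3;q^3)_k\,(q^6;q^6)_l}$$ $$=\sum_{i,j\ge 0}\frac{x^{i+2j}q^{2i^2+6ij+6j^2+i}}{(q;q)_i\,(q^3;q^3)_j}+\sum_{i,j\ge 0}\frac{x^{i+2j+1}q^{2i^2+6ij+6j^2+4i+6j+1}}{(q;q)_i\,(q^3;q^3)_j}.$$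
   Context: Partitions are finite weakly increasing sequences of positive integers (the empty partition is included); $\ell(\pi)$ is the number of parts and $|\pi|$ the sum of the parts of $\pi$. For $n\ge 0$, $(a;q)_n=\prod_{0\le t<n}(1-aq^t)$. All identities are identities of formal power series. *)

theory Defs
  imports "HOL-Analysis.Analysis"
begin

text \<open>
  Bivariate formal power series are elements of \<open>rat fps fps\<close>: the outer variable is \<open>q\<close>, the
  inner one is \<open>x\<close>. The library topology on this type is the \<open>q\<close>-adic one. The order of the two
  variables matters: a given sum of parts is attained by finitely many partitions, but a given
  number of parts by infinitely many, so the generating functions below would not converge
  \<open>x\<close>-adically.
\<close>

abbreviation var_q :: "rat fps fps" where
  "var_q \<equiv> fps_X"

abbreviation var_x :: "rat fps fps" where
  "var_x \<equiv> fps_const fps_X"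

definition qpoch :: "'a::comm_ring_1 \<Rightarrow> 'a \<Rightarrow> nat \<Rightarrow> 'a" where
  "qpoch a q n = (\<Prod>t<n. 1 - a * q ^ t)"

text \<open>
  The coefficient ring \<open>rat fps\<close> is not a field, so division of series over it is not a true
  quotient in general; it is one for the denominators used here, which are products of
  \<open>q\<close>-Pochhammer symbols and thus have constant term \<open>1\<close>.
\<close>

lemma fps_fps_divide_mult:
  fixes f g :: "rat fps fps"
  assumes "fps_nth g 0 = 1"
  shows "f / g * g = f"
proof -
  have "inverse g * g = 1"
    using fps_left_inverse'[of "inverse (fps_nth g 0)" g "inverse (fps_nth g 0)"]
    by (simp add: assms fps_inverse_def[of g])
  then show ?thesis
    using assms by (simp add: fps_divide_unit mult.assoc)
qed

lemma fps_nth_qpoch_0: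
  "m > 0 \<Longrightarrow> fps_nth (qpoch (var_q ^ m) (var_q ^ m) n) 0 = 1"
  unfolding qpoch_def by (induction n) (auto simp: fps_mult_nth_0 fps_nth_power_0)

definition partitions :: "nat list set" where
  "partitions = {\<pi>. sorted \<pi> \<and> (\<forall>p\<in>set \<pi>. 0 < p)}"

definition C_parts :: "nat list set" where
  "C_parts = {\<pi> \<in> partitions. \<forall>i. Suc i < length \<pi> \<longrightarrow>
     \<pi> ! Suc i - \<pi> ! i \<ge> 2 \<and>
     (\<pi> ! Suc i - \<pi> ! i \<in> {2, 3} \<longrightarrow> 3 dvd \<pi> ! i + \<pi> ! Suc i)}"

definition P1 :: "nat list set" where
  "P1 = {\<pi> \<in> C_parts. 1 \<notin> set \<pi>}"

definition P2 :: "nat list set" where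
  "P2 = {\<pi> \<in> C_parts. 2 \<notin> set \<pi>}"

end

theory Submission
  imports Defs
begin

unbundle no vec_syntax and fps_syntax

text \<open>
  Adding 3 to every part preserves the gap conditions, so, with \<open>C\<^sub>m(x)\<close> the generating
  function of the members of \<open>\<C>\<close> with all parts at least \<open>m\<close>, one has
  \<open>C\<^sub>m\<^sub>+\<^sub>3(x) = C\<^sub>m(xq\<^sup>3)\<close>. Removing the smallest part gives a system of \<open>q\<close>-difference equations
  for \<open>a = C\<^sub>2\<close> and \<open>b = C\<^sub>3\<close> which determines both. Put
  \<open>S(u, v) = \<Sum> x\<^sup>i\<^sup>+\<^sup>2\<^sup>j q^(2i\<^sup>2 + 6ij + 6j\<^sup>2 + ui + vj) / ((q;q)\<^sub>i (q\<^sup>3;q\<^sup>3)\<^sub>j)\<close>. The contiguous relations of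
  \<open>S\<close> show that \<open>a = S(0, 0)\<close>, \<open>b = S(1, 3)\<close> is the solution.

  The generating function of \<open>\<P>\<^sub>2\<close> is \<open>b(x) + xq a(xq\<^sup>3)\<close>, equal to \<open>S(1, 0) + xq S(4, 6)\<close>. By elimination
  it satisfies a third-order \<open>q\<close>-difference equation, which also holds for the four-fold sum:
  the latter is obtained from the expansion of
  \<open>(-xq;q\<^sup>3)\<^sub>\<infinity> (-xq\<^sup>5;q\<^sup>3)\<^sub>\<infinity> / ((xq\<^sup>3;q\<^sup>3)\<^sub>\<infinity> (x\<^sup>2q\<^sup>3;q\<^sup>6)\<^sub>\<infinity>)\<close>
  by multiplying the coefficient of \<open>x\<^sup>R\<close> by \<open>q\<close> to the power \<open>3R(R-1)/2\<close>.
\<close>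

section \<open>Exchanging the two variables\<close>

text \<open>
  The identities are proved coefficientwise in \<open>x\<close>, in \<open>rat fps fps\<close> with \<^emph>\<open>outer\<close> variable \<open>x\<close>:
  for a fixed power of \<open>x\<close> the sums over indices are finite. So, except inside \<open>swap_vars\<close>-images,
  \<open>fps_X\<close> stands for \<open>x\<close> and \<open>qconst\<close> below for \<open>q\<close>.
\<close>

definition swap_vars :: "'a::comm_ring_1 fps fps \<Rightarrow> 'a fps fps" where
  "swap_vars f = Abs_fps (\<lambda>N. Abs_fps (\<lambda>n. f $ n $ N))"

lemma swap_vars_nth [simp]: "swap_vars f $ N $ n = f $ n $ N"
  by (simp add: swap_vars_def)

lemma fps_fps_eqI: "(\<And>n N. f $ n $ N = g $ n $ N) \<Longrightarrow> f = g"
  by (simp add: fps_eq_iff)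

lemma swap_vars_add: "swap_vars (f + g) = swap_vars f + swap_vars g"
  by (rule fps_fps_eqI) simp

lemma swap_vars_diff: "swap_vars (f - g) = swap_vars f - swap_vars g"
  by (rule fps_fps_eqI) simp

lemma swap_vars_mult: "swap_vars (f * g) = swap_vars f * swap_vars g"
  by (rule fps_fps_eqI, simp add: fps_mult_nth fps_sum_nth, rule sum.swap)

lemma swap_vars_1 [simp]: "swap_vars 1 = 1"
  by (rule fps_fps_eqI) (simp add: fps_one_nth)

lemma swap_vars_power: "swap_vars (f ^ n) = swap_vars f ^ n"
  by (induction n) (simp_all add: swap_vars_mult)

lemma swap_vars_X: "swap_vars fps_X = fps_const fps_X"
  by (rule fps_fps_eqI) (simp add: fps_X_def)

lemma swap_vars_const_X: "swap_vars (fps_const fps_X) = fps_X"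
  by (rule fps_fps_eqI) (simp add: fps_X_def)

lemma swap_vars_qpoch:
  "swap_vars (fps_const (qpoch a c n)) = qpoch (swap_vars (fps_const a)) (swap_vars (fps_const c)) n"
proof (induction n)
  case (Suc n)
  have "fps_const (1 - a * c ^ n) = 1 - fps_const a * fps_const c ^ n"
    by (simp flip: fps_const_sub)
  then have "swap_vars (fps_const (1 - a * c ^ n)) = 1 - swap_vars (fps_const a) * swap_vars (fps_const c) ^ n"
    by (simp only: swap_vars_mult swap_vars_diff swap_vars_power swap_vars_1)
  with Suc show ?case
    by (simp add: qpoch_def swap_vars_mult flip: fps_const_mult)
qed (simp add: qpoch_def)

text \<open>q-adic convergence concerns one power of q at a time, and only finitely many indices
  contribute to each. The hypothesis on \<open>f\<close> then merely sorts that finite sum by the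
  exponent of x.\<close>

lemma has_sum_swap_vars:
  fixes c :: "'i \<Rightarrow> 'a::comm_ring_1 fps"
  assumes fin: "\<And>N. finite {i\<in>I. c i $ N \<noteq> 0}"
    and f: "\<And>n N. f $ n $ N = (\<Sum>i | i \<in> I \<and> r i = n \<and> c i $ N \<noteq> 0. c i $ N)"
  shows "((\<lambda>i. swap_vars (fps_X ^ r i * fps_const (c i))) has_sum swap_vars f) I"
proof (rule has_sum_fpsI)
  fix N
  have nth: "swap_vars (fps_X ^ r i * fps_const (c i)) $ N = fps_const (c i $ N) * fps_X ^ r i" for i
    by (rule fps_ext) (simp add: fps_X_power_mult_nth)
  have eq: "{i\<in>I. swap_vars (fps_X ^ r i * fps_const (c i)) $ N \<noteq> 0} = {i\<in>I. c i $ N \<noteq> 0}"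
    unfolding nth by (auto simp: fps_eq_iff)
  show "finite {i\<in>I. swap_vars (fps_X ^ r i * fps_const (c i)) $ N \<noteq> 0}"
    unfolding eq by (rule fin)
  show "swap_vars f $ N = (\<Sum>i | i \<in> I \<and> swap_vars (fps_X ^ r i * fps_const (c i)) $ N \<noteq> 0.
          swap_vars (fps_X ^ r i * fps_const (c i)) $ N)"
    unfolding eq unfolding nth
  proof (rule fps_ext)
    fix n
    have "(\<Sum>i | i \<in> I \<and> c i $ N \<noteq> 0. fps_const (c i $ N) * fps_X ^ r i) $ n
        = (\<Sum>i | i \<in> I \<and> c i $ N \<noteq> 0. if r i = n then c i $ N else 0)"
      by (auto simp: fps_sum_nth intro!: sum.cong)
    also have "\<dots> = (\<Sum>i | i \<in> I \<and> r i = n \<and> c i $ N \<noteq> 0. c i $ N)"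
      using fin[of N] by (intro sum.mono_neutral_cong_right) auto
    finally show "swap_vars f $ N $ n = (\<Sum>i | i \<in> I \<and> c i $ N \<noteq> 0. fps_const (c i $ N) * fps_X ^ r i) $ n"
      by (simp add: f)
  qed
qed

section \<open>Sums graded by a weight\<close>

text \<open>Only meaningful when the fibres of the weight \<open>r\<close> are finite.\<close>
definition sum_by :: "('i \<Rightarrow> nat) \<Rightarrow> ('i \<Rightarrow> 'a::comm_ring_1) \<Rightarrow> 'a fps" where
  "sum_by r c = Abs_fps (\<lambda>n. \<Sum>p | r p = n. c p)"

lemma sum_by_diff: "sum_by r c - sum_by r d = sum_by r (\<lambda>p. c p - d p)"
  by (rule fps_ext) (simp add: sum_by_def sum_subtractf)

text \<open>The source of the contiguous relations below: there \<open>\<phi>\<close> raises one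
  summation index, and the terms it misses, with that index 0, cancel. The change of weight becomes
  a power of x, the factor \<open>e\<close> a power of q.\<close>

lemma sum_by_reindex:
  assumes "inj \<phi>"
    and r: "\<And>p. s (\<phi> p) = r p + k"
    and c: "\<And>p. d (\<phi> p) = e * c p"
    and z: "\<And>p. p \<notin> range \<phi> \<Longrightarrow> d p = 0"
    and fin: "\<And>n. finite {p. s p = n}"
  shows "sum_by s d = fps_X ^ k * (fps_const e * sum_by r c)"
proof (rule fps_ext)
  fix n
  have "(\<Sum>p | s p = n. d p) = (\<Sum>p\<in>\<phi> ` {p. r p + k = n}. d p)"
  proof (rule sum.mono_neutral_right)
    show "\<forall>i\<in>{p. s p = n} - \<phi> ` {p. r p + k = n}. d i = 0"
    proof
      fix i assume i: "i \<in> {p. s p = n} - \<phi> ` {p. r p + k = n}"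
      have "i \<notin> range \<phi>"
      proof
        assume "i \<in> range \<phi>"
        then obtain p where "i = \<phi> p" by blast
        with i r[of p] show False by auto
      qed
      then show "d i = 0" by (rule z)
    qed
  qed (use fin r in auto)
  also have "\<dots> = (\<Sum>p | r p + k = n. e * c p)"
    using assms(1) by (subst sum.reindex) (auto simp: c intro: inj_on_subset)
  also have "\<dots> = (if n < k then 0 else e * (\<Sum>p | r p = n - k. c p))"
    by (auto simp: sum_distrib_left intro!: sum.neutral sum.cong)
  finally show "sum_by s d $ n = (fps_X ^ k * (fps_const e * sum_by r c)) $ n"
    by (simp add: sum_by_def fps_X_power_mult_nth)
qed

text \<open>Divisibility makes \<open>e p\<close> a lower bound for the q-order of
  \<open>c p\<close>, so only the finitely many p with \<open>e p \<le> N\<close> can contribute to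
  q^N.\<close>

lemma has_sum_sum_by:
  fixes c :: "'i \<Rightarrow> 'a::comm_ring_1 fps"
  assumes fin: "\<And>n. finite {p. r p = n}" and fin': "\<And>N. finite {p. e p \<le> (N::nat)}"
    and c: "\<And>p. \<exists>d. c p = fps_X ^ e p * d"
  shows "((\<lambda>i. swap_vars (fps_X ^ r i * fps_const (c i))) has_sum swap_vars (sum_by r c)) UNIV"
proof (rule has_sum_swap_vars)
  fix N
  have "c p $ N = 0" if "N < e p" for p
    using c[of p] that by (auto simp: fps_X_power_mult_nth)
  then show "finite {p \<in> UNIV. c p $ N \<noteq> 0}"
    by (intro finite_subset[OF _ fin'[of N]]) (auto simp flip: not_less)
  fix n
  show "sum_by r c $ n $ N = (\<Sum>p | p \<in> UNIV \<and> r p = n \<and> c p $ N \<noteq> 0. c p $ N)"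
    by (auto simp: sum_by_def fps_sum_nth intro!: sum.mono_neutral_right fin)
qed

definition inv_qpoch :: "nat \<Rightarrow> nat \<Rightarrow> rat fps" where
  "inv_qpoch k n = inverse (qpoch (fps_X ^ k) (fps_X ^ k) n)"

lemma inv_qpoch_Suc:
  assumes "k > 0"
  shows "inv_qpoch k (Suc n) * (1 - fps_X ^ (k * Suc n)) = inv_qpoch k n"
proof -
  have "inverse (1 - fps_X ^ (k * Suc n) :: rat fps) * (1 - fps_X ^ (k * Suc n)) = 1"
    using assms by (intro inverse_mult_eq_1) (simp add: fps_X_power_iff)
  then show ?thesis
    by (simp add: inv_qpoch_def qpoch_def fps_inverse_mult power_add power_mult mult.assoc)
qed

lemma inv_qpoch_mult: "k > 0 \<Longrightarrow> inv_qpoch k n * qpoch (fps_X ^ k) (fps_X ^ k) n = 1"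
proof -
  assume "k > 0"
  then have "qpoch (fps_X ^ k :: rat fps) (fps_X ^ k) n $ 0 = 1"
    unfolding qpoch_def by (induction n) (auto simp: fps_mult_nth_0 fps_nth_power_0)
  then show ?thesis unfolding inv_qpoch_def by (intro inverse_mult_eq_1) simp
qed

section \<open>The substitution of \<open>xq\<^sup>3\<close> for \<open>x\<close> and \<open>q\<close>-difference equations\<close>

definition dilate :: "rat fps fps \<Rightarrow> rat fps fps" where
  "dilate f = Abs_fps (\<lambda>n. fps_X ^ (3 * n) * f $ n)"

lemma dilate_nth [simp]: "dilate f $ n = fps_X ^ (3 * n) * f $ n"
  by (simp add: dilate_def)

lemma dilate_add: "dilate (f + g) = dilate f + dilate g"
  by (rule fps_ext) (simp add: algebra_simps)

lemma dilate_diff: "dilate (f - g) = dilate f - dilate g"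
  by (rule fps_ext) (simp add: algebra_simps)

lemma dilate_mult: "dilate (f * g) = dilate f * dilate g"
proof (rule fps_ext)
  fix n
  have "fps_X ^ (3 * n) * (f $ i * g $ (n - i)) = fps_X ^ (3 * i) * f $ i * (fps_X ^ (3 * (n - i)) * g $ (n - i))"
    if "i \<le> n" for i
  proof -
    have "3 * n = 3 * i + 3 * (n - i)" using that by simp
    then show ?thesis by (simp only: power_add mult_ac)
  qed
  then show "dilate (f * g) $ n = (dilate f * dilate g) $ n"
    unfolding dilate_nth fps_mult_nth sum_distrib_left by (intro sum.cong) auto
qed

definition qconst :: "rat fps fps" where
  "qconst = fps_const fps_X"

lemma fps_const_X_power: "fps_const (fps_X ^ n) = qconst ^ n"
  by (simp add: qconst_def)

lemma dilate_qconst: "dilate qconst = qconst"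
  by (rule fps_ext) (simp add: qconst_def)

lemma dilate_X: "dilate fps_X = qconst ^ 3 * fps_X"
  by (rule fps_ext) (simp add: qconst_def fps_X_def)

lemma dilate_power: "dilate (f ^ n) = dilate f ^ n"
proof (induction n)
  case 0
  show ?case by (rule fps_ext) simp
qed (simp add: dilate_mult)

lemmas dilate_simps = dilate_add dilate_diff dilate_mult dilate_power dilate_qconst dilate_X

section \<open>Uniqueness for the q-difference equations, and elimination\<close>

lemma fps_eq_X_power_mult_imp_0:
  fixes c :: "'a::idom fps"
  assumes "c = fps_X ^ m * c" and "m > 0"
  shows "c = 0"
proof -
  have "c * (1 - fps_X ^ m) = 0"
    using assms(1) by (simp add: algebra_simps)
  moreover have "(1 - fps_X ^ m :: 'a fps) $ 0 = 1"
    using assms(2) by (simp only: fps_sub_nth fps_X_power_nth fps_one_nth) simp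
  then have "1 - fps_X ^ m \<noteq> (0 :: 'a fps)" by force
  ultimately show ?thesis by simp
qed

text \<open>Compare coefficients of x^n: a term with an explicit factor x involves earlier
  coefficients, zero by induction. What is left is a_n = b_n and b_n = q^(3n) a_n. This forces both
  to vanish for n > 0 but is void for a_0, hence the initial condition.\<close>

lemma system_zero:
  fixes a b :: "rat fps fps"
  assumes E1: "a = b + fps_X * (qconst ^ 2 * dilate b) + fps_X * (fps_X * (qconst ^ 6 * dilate (dilate a)))"
    and E2: "b = dilate a + fps_X * (qconst ^ 4 * dilate (dilate a)) + fps_X * (qconst ^ 3 * dilate b)"
    and a0: "a $ 0 = 0"
  shows "a = 0 \<and> b = 0"
proof -
  have "a $ n = 0 \<and> b $ n = 0" for n
  proof (induction n rule: less_induct)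
    case (less n)
    have b: "b $ n = fps_X ^ (3 * n) * a $ n"
      using arg_cong[OF E2, of "\<lambda>f. f $ n"] less.IH[of "n - 1"]
      by (cases n) (simp_all flip: fps_const_X_power)
    have a: "a $ n = b $ n"
      using arg_cong[OF E1, of "\<lambda>f. f $ n"] less.IH[of "n - 1"] less.IH[of "n - 2"]
      by (cases n; cases "n - 1") (simp_all flip: fps_const_X_power)
    have "a $ n = 0"
    proof (cases "n = 0")
      case False
      with a b show ?thesis by (intro fps_eq_X_power_mult_imp_0[of _ "3 * n"]) simp_all
    qed (use a0 in simp)
    with a show ?case by simp
  qed
  then show ?thesis by (auto simp: fps_eq_iff)
qed

lemma third_order_zero:
  fixes t :: "rat fps fps"
  assumes E: "t = (fps_X * (qconst ^ 3 * dilate t) + fps_X * (fps_X * (qconst ^ 6 * dilate (dilate t)))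
         - fps_X * (fps_X * (fps_X * (qconst ^ 15 * dilate (dilate (dilate t))))))
       + (dilate t + fps_X * (qconst * dilate (dilate t)) + fps_X * (qconst ^ 5 * dilate (dilate t))
         + fps_X * (fps_X * (qconst ^ 9 * dilate (dilate (dilate t)))))"
    and t0: "t $ 0 = 0"
  shows "t = 0"
proof -
  have "t $ n = 0" for n
  proof (induction n rule: less_induct)
    case (less n)
    show ?case
    proof (cases "n = 0")
      case False
      \<comment> \<open>\<open>Z f\<close> says that f has x-order at least n. The operators on the
        right preserve it, so every term with a factor x drops out at x^n and only
        \<open>dilate t\<close> survives.\<close>
      define Z where "Z f \<longleftrightarrow> (\<forall>m<n. f $ m = 0)" for f :: "rat fps fps"
      have Z: "Z (dilate f)" "Z (fps_X * f)" "Z (qconst * f)" "Z (qconst ^ k * f)" "(fps_X * f) $ n = 0"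
        if "Z f" for f k
        using that by (auto simp: Z_def qconst_def)
      have "Z t" using less.IH by (simp add: Z_def)
      then have "t $ n = fps_X ^ (3 * n) * t $ n"
        using arg_cong[OF E, of "\<lambda>f. f $ n"] by (simp only: Z fps_add_nth fps_sub_nth dilate_nth) simp
      with False show ?thesis by (intro fps_eq_X_power_mult_imp_0[of _ "3 * n"]) simp_all
    qed (use t0 in simp)
  qed
  then show ?thesis by (auto simp: fps_eq_iff)
qed

text \<open>Dilating the system repeatedly supplies enough linear equations to eliminate a and b in
  favour of g and its first three dilations.\<close>

lemma system_third_order:
  fixes a b g :: "rat fps fps"
  assumes E1: "a = b + fps_X * (qconst ^ 2 * dilate b) + fps_X * (fps_X * (qconst ^ 6 * dilate (dilate a)))"
    and E2: "b = dilate a + fps_X * (qconst ^ 4 * dilate (dilate a)) + fps_X * (qconst ^ 3 * dilate b)"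
    and g: "g = b + fps_X * (qconst * dilate a)"
  shows "g = (fps_X * (qconst ^ 3 * dilate g) + fps_X * (fps_X * (qconst ^ 6 * dilate (dilate g)))
         - fps_X * (fps_X * (fps_X * (qconst ^ 15 * dilate (dilate (dilate g))))))
       + (dilate g + fps_X * (qconst * dilate (dilate g)) + fps_X * (qconst ^ 5 * dilate (dilate g))
         + fps_X * (fps_X * (qconst ^ 9 * dilate (dilate (dilate g)))))"
proof -
  define a1 a2 a3 a4 where "a1 = dilate a" "a2 = dilate a1" "a3 = dilate a2" "a4 = dilate a3"
  define b1 b2 b3 where "b1 = dilate b" "b2 = dilate b1" "b3 = dilate b2"
  note defs = a1_a2_a3_a4_def b1_b2_b3_def
  let ?x = "fps_X :: rat fps fps" and ?q = qconst
  have e: "b = a1 + ?x * ?q ^ 4 * a2 + ?x * ?q ^ 3 * b1"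
    using E2 by (simp add: defs mult.assoc)
  have e1: "b1 = a2 + ?x * ?q ^ 7 * a3 + ?x * ?q ^ 6 * b2"
    using arg_cong[OF e, of dilate] unfolding dilate_simps defs by algebra
  have e2: "b2 = a3 + ?x * ?q ^ 10 * a4 + ?x * ?q ^ 9 * b3"
    using arg_cong[OF e1, of dilate] unfolding dilate_simps defs by algebra
  have f: "a = b + ?x * ?q ^ 2 * b1 + ?x ^ 2 * ?q ^ 6 * a2"
    using E1 by (simp add: defs mult.assoc power2_eq_square)
  have f1: "a1 = b1 + ?x * ?q ^ 5 * b2 + ?x ^ 2 * ?q ^ 12 * a3"
    using arg_cong[OF f, of dilate] unfolding dilate_simps defs by algebra
  have f2: "a2 = b2 + ?x * ?q ^ 8 * b3 + ?x ^ 2 * ?q ^ 18 * a4"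
    using arg_cong[OF f1, of dilate] unfolding dilate_simps defs by algebra
  have g0: "g = b + ?x * ?q * a1"
    using g by (simp add: defs mult.assoc)
  have g1: "dilate g = b1 + ?x * ?q ^ 4 * a2"
    unfolding g0 dilate_simps defs by algebra
  have g2: "dilate (dilate g) = b2 + ?x * ?q ^ 7 * a3"
    unfolding g1 dilate_simps defs by algebra
  have g3: "dilate (dilate (dilate g)) = b3 + ?x * ?q ^ 10 * a4"
    unfolding g2 dilate_simps defs by algebra
  \<comment> \<open>The five equations are triangular: they rewrite \<open>b\<close>,
    \<open>a1\<close>, \<open>b1\<close>, \<open>a2\<close>, \<open>b2\<close> successively down to
    \<open>a3\<close>, \<open>a4\<close>, \<open>b3\<close>, which leaves a polynomial
    identity.\<close>
  show ?thesis
    unfolding g3 unfolding g2 unfolding g1 unfolding g0 e f1 e1 f2 e2 by algebra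
qed

section \<open>The double and the four-fold sum\<close>

lemma eq_add_if_diff_eq: "a - b = c \<Longrightarrow> a = b + (c :: 'a::ab_group_add)"
  by (simp add: algebra_simps)

text \<open>The difference of the two powers yields the factor 1 - q^(k(n+1)), which cancels the
  last factor of the Pochhammer symbol and lowers its index to n. The denominators left alone are
  collected in \<open>g\<close>.\<close>

lemma inv_qpoch_step:
  assumes "k > 0" and "e = s + e0" and "e' = e + k * Suc n"
    and "d = inv_qpoch k (Suc n) * g" and "d0 = inv_qpoch k n * g"
  shows "fps_X ^ e * d - fps_X ^ e' * d = fps_X ^ s * (fps_X ^ e0 * d0)"
proof -
  have "fps_X ^ e * d - fps_X ^ e' * d = fps_X ^ e * ((inv_qpoch k (Suc n) * (1 - fps_X ^ (k * Suc n))) * g)"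
    unfolding assms(3,4) power_add[of _ e]
    by (simp only: right_diff_distrib left_diff_distrib mult_1_right mult_1_left mult_ac)
  also have "\<dots> = fps_X ^ s * (fps_X ^ e0 * d0)"
    unfolding inv_qpoch_Suc[OF assms(1)] assms(2,5) power_add by (simp only: mult.assoc)
  finally show ?thesis .
qed

section \<open>The double sum S(u, v) and its contiguous relations\<close>

definition double_series :: "nat \<Rightarrow> nat \<Rightarrow> rat fps fps" where
  "double_series u v = sum_by (\<lambda>(i, j). i + 2 * j)
     (\<lambda>(i, j). fps_X ^ (2 * i^2 + 6 * i * j + 6 * j^2 + u * i + v * j)
        * (inv_qpoch 1 i * inv_qpoch 3 j))"

lemma finite_double_weight: "finite {p. (case p of (i, j) \<Rightarrow> i + 2 * j) = (n::nat)}"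
  by (rule finite_subset[of _ "{..n} \<times> {..n}"]) auto

lemma dilate_double_series: "dilate (double_series u v) = double_series (u + 3) (v + 6)"
  by (rule fps_ext)
     (auto simp: double_series_def sum_by_def sum_distrib_left algebra_simps simp flip: power_add
       intro!: sum.cong)

text \<open>Corresponding terms differ by the factor 1 - q^i, which vanishes at i = 0. Replacing i
  by i + 1 adds 4i + 6j + u + 2 to the exponent, whence the new parameters.\<close>

lemma double_series_step_i:
  "double_series u v = double_series (u + 1) v + fps_X * (qconst ^ (u + 2) * double_series (u + 4) (v + 6))"
proof -
  have "double_series u v - double_series (u + 1) v
      = fps_X ^ 1 * (fps_const (fps_X ^ (u + 2)) * double_series (u + 4) (v + 6))"
    unfolding double_series_def sum_by_diff
  proof (rule sum_by_reindex[where \<phi> = "\<lambda>(i, j). (Suc i, j)"], goal_cases)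
    case (3 p)
    obtain i j where p: "p = (i, j)" by force
    show ?case
      unfolding p prod.case
      by (rule inv_qpoch_step[where k = 1 and n = i and g = "inv_qpoch 3 j"])
         (simp_all add: algebra_simps power2_eq_square)
  next
    case (4 p)
    then show ?case by (cases p; cases "fst p") (auto simp: image_iff)
  qed (auto intro!: injI finite_double_weight)
  then show ?thesis
    unfolding fps_const_X_power power_one_right by (rule eq_add_if_diff_eq)
qed

text \<open>Now the factor is 1 - q^(3j); raising j adds 6i + 12j + v + 6 to the exponent of q and 2
  to that of x.\<close>

lemma double_series_step_j:
  "double_series u v = double_series u (v + 3)
     + fps_X ^ 2 * (qconst ^ (v + 6) * double_series (u + 6) (v + 12))"
proof -
  have "double_series u v - double_series u (v + 3)
      = fps_X ^ 2 * (fps_const (fps_X ^ (v + 6)) * double_series (u + 6) (v + 12))"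
    unfolding double_series_def sum_by_diff
  proof (rule sum_by_reindex[where \<phi> = "\<lambda>(i, j). (i, Suc j)"], goal_cases)
    case (3 p)
    obtain i j where p: "p = (i, j)" by force
    show ?case
      unfolding p prod.case
      by (rule inv_qpoch_step[where k = 3 and n = j and g = "inv_qpoch 1 i"])
         (simp_all add: algebra_simps power2_eq_square)
  next
    case (4 p)
    then show ?case by (cases p; cases "snd p") (auto simp: image_iff)
  qed (auto intro!: injI finite_double_weight)
  then show ?thesis
    unfolding fps_const_X_power power_one_right by (rule eq_add_if_diff_eq)
qed

lemma double_series_nth_0: "double_series u v $ 0 = 1"
proof -
  have "{p. (case p of (i, j) \<Rightarrow> i + 2 * j) = (0::nat)} = {(0, 0)}" by auto
  then show ?thesis
    by (simp add: double_series_def sum_by_def inv_qpoch_def qpoch_def)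
qed

section \<open>The four-fold sum and its contiguous relations\<close>

text \<open>By Euler's expansions, omitting \<open>3 * ((i + j + k + 2 * l) choose 2)\<close> from
  the exponent would give a product of four infinite Pochhammer symbols. The parameters \<alpha>,
  \<beta>, \<gamma>, \<delta> belong to 1/(xq^\<alpha>;q^3), (-xq^\<beta>;q^3), (-xq^\<gamma>;q^3)
  and 1/(x^2q^\<delta>;q^6).\<close>

definition quadruple_series :: "nat \<Rightarrow> nat \<Rightarrow> nat \<Rightarrow> nat \<Rightarrow> rat fps fps" where
  "quadruple_series \<alpha> \<beta> \<gamma> \<delta> = sum_by (\<lambda>(i, j, k, l). i + j + k + 2 * l)
     (\<lambda>(i, j, k, l). fps_X ^ (3 * ((i + j + k + 2 * l) choose 2) + \<alpha> * i
          + (\<beta> * j + 3 * (j choose 2)) + (\<gamma> * k + 3 * (k choose 2)) + \<delta> * l)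
        * (inv_qpoch 3 i * inv_qpoch 3 j * inv_qpoch 3 k * inv_qpoch 6 l))"

lemma finite_quadruple_weight:
  "finite {p. (case p of (i, j, k, l) \<Rightarrow> i + j + k + 2 * l) = (n::nat)}"
  by (rule finite_subset[of _ "{..n} \<times> {..n} \<times> {..n} \<times> {..n}"]) auto

lemma dilate_quadruple_series:
  "dilate (quadruple_series \<alpha> \<beta> \<gamma> \<delta>) = quadruple_series (\<alpha> + 3) (\<beta> + 3) (\<gamma> + 3) (\<delta> + 6)"
proof (rule fps_ext)
  fix n
  have "fps_X ^ (3 * (i + j + k + 2 * l)) * (fps_X ^ (3 * ((i + j + k + 2 * l) choose 2) + \<alpha> * i
          + (\<beta> * j + 3 * (j choose 2)) + (\<gamma> * k + 3 * (k choose 2)) + \<delta> * l) * c)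
      = fps_X ^ (3 * ((i + j + k + 2 * l) choose 2) + (\<alpha> + 3) * i
          + ((\<beta> + 3) * j + 3 * (j choose 2)) + ((\<gamma> + 3) * k + 3 * (k choose 2)) + (\<delta> + 6) * l) * (c::rat fps)"
    for i j k l c
    unfolding mult.assoc[symmetric] power_add[symmetric]
    by (rule arg_cong[where f = "\<lambda>e. fps_X ^ e * c"]) (simp add: algebra_simps)
  then show "dilate (quadruple_series \<alpha> \<beta> \<gamma> \<delta>) $ n
      = quadruple_series (\<alpha> + 3) (\<beta> + 3) (\<gamma> + 3) (\<delta> + 6) $ n"
    unfolding quadruple_series_def sum_by_def dilate_nth fps_nth_Abs_fps sum_distrib_left
    by (intro sum.cong) auto
qed

lemma choose_2_Suc: "Suc n choose 2 = n + (n choose 2)"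
  by (simp add: numeral_2_eq_2)

text \<open>Raising i raises R = i + j + k + 2l by one, hence 3R(R-1)/2 by 3R; the weight q^(3R) is
  exactly a dilation.\<close>

lemma quadruple_series_step_i:
  "quadruple_series \<alpha> \<beta> \<gamma> \<delta> = quadruple_series (\<alpha> + 3) \<beta> \<gamma> \<delta>
     + fps_X * (qconst ^ \<alpha> * dilate (quadruple_series \<alpha> \<beta> \<gamma> \<delta>))"
proof -
  have "quadruple_series \<alpha> \<beta> \<gamma> \<delta> - quadruple_series (\<alpha> + 3) \<beta> \<gamma> \<delta>
      = fps_X ^ 1 * (fps_const (fps_X ^ \<alpha>) * quadruple_series (\<alpha> + 3) (\<beta> + 3) (\<gamma> + 3) (\<delta> + 6))"
    unfolding quadruple_series_def sum_by_diff
  proof (rule sum_by_reindex[where \<phi> = "\<lambda>(i, j, k, l). (Suc i, j, k, l)"], goal_cases)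
    case (3 p)
    obtain i j k l where p: "p = (i, j, k, l)" by (cases p) auto
    show ?case
      unfolding p prod.case
      by (rule inv_qpoch_step[where k = 3 and n = i and g = "inv_qpoch 3 j * inv_qpoch 3 k * inv_qpoch 6 l"])
         (simp_all add: choose_2_Suc algebra_simps)
  next
    case (4 p)
    obtain i j k l where "p = (i, j, k, l)" by (cases p) auto
    with 4 show ?case by (cases i) (auto simp: image_iff)
  qed (auto intro!: injI finite_quadruple_weight)
  then show ?thesis
   
    unfolding fps_const_X_power dilate_quadruple_series power_one_right by (rule eq_add_if_diff_eq)
qed

text \<open>Here \<open>3 * (j choose 2)\<close> grows as well, by 3j, so \<beta> + 3 persists
  inside the dilation.\<close>

lemma quadruple_series_step_j:
  "quadruple_series \<alpha> \<beta> \<gamma> \<delta> = quadruple_series \<alpha> (\<beta> + 3) \<gamma> \<delta>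
     + fps_X * (qconst ^ \<beta> * dilate (quadruple_series \<alpha> (\<beta> + 3) \<gamma> \<delta>))"
proof -
  have "quadruple_series \<alpha> \<beta> \<gamma> \<delta> - quadruple_series \<alpha> (\<beta> + 3) \<gamma> \<delta>
      = fps_X ^ 1 * (fps_const (fps_X ^ \<beta>) * quadruple_series (\<alpha> + 3) (\<beta> + 3 + 3) (\<gamma> + 3) (\<delta> + 6))"
    unfolding quadruple_series_def sum_by_diff
  proof (rule sum_by_reindex[where \<phi> = "\<lambda>(i, j, k, l). (i, Suc j, k, l)"], goal_cases)
    case (3 p)
    obtain i j k l where p: "p = (i, j, k, l)" by (cases p) auto
    show ?case
      unfolding p prod.case
      by (rule inv_qpoch_step[where k = 3 and n = j and g = "inv_qpoch 3 i * inv_qpoch 3 k * inv_qpoch 6 l"])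
         (simp_all add: choose_2_Suc algebra_simps)
  next
    case (4 p)
    obtain i j k l where "p = (i, j, k, l)" by (cases p) auto
    with 4 show ?case by (cases j) (auto simp: image_iff)
  qed (auto intro!: injI finite_quadruple_weight)
  then show ?thesis
   
    unfolding fps_const_X_power dilate_quadruple_series power_one_right by (rule eq_add_if_diff_eq)
qed

lemma quadruple_series_step_k:
  "quadruple_series \<alpha> \<beta> \<gamma> \<delta> = quadruple_series \<alpha> \<beta> (\<gamma> + 3) \<delta>
     + fps_X * (qconst ^ \<gamma> * dilate (quadruple_series \<alpha> \<beta> (\<gamma> + 3) \<delta>))"
proof -
  have "quadruple_series \<alpha> \<beta> \<gamma> \<delta> - quadruple_series \<alpha> \<beta> (\<gamma> + 3) \<delta>
      = fps_X ^ 1 * (fps_const (fps_X ^ \<gamma>) * quadruple_series (\<alpha> + 3) (\<beta> + 3) (\<gamma> + 3 + 3) (\<delta> + 6))"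
    unfolding quadruple_series_def sum_by_diff
  proof (rule sum_by_reindex[where \<phi> = "\<lambda>(i, j, k, l). (i, j, Suc k, l)"], goal_cases)
    case (3 p)
    obtain i j k l where p: "p = (i, j, k, l)" by (cases p) auto
    show ?case
      unfolding p prod.case
      by (rule inv_qpoch_step[where k = 3 and n = k and g = "inv_qpoch 3 i * inv_qpoch 3 j * inv_qpoch 6 l"])
         (simp_all add: choose_2_Suc algebra_simps)
  next
    case (4 p)
    obtain i j k l where "p = (i, j, k, l)" by (cases p) auto
    with 4 show ?case by (cases k) (auto simp: image_iff)
  qed (auto intro!: injI finite_quadruple_weight)
  then show ?thesis
   
    unfolding fps_const_X_power dilate_quadruple_series power_one_right by (rule eq_add_if_diff_eq)
qed

text \<open>Raising l raises R by two and 3R(R-1)/2 by 6R + 3, which accounts for two dilations and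
  an extra q^3.\<close>

lemma quadruple_series_step_l:
  "quadruple_series \<alpha> \<beta> \<gamma> \<delta> = quadruple_series \<alpha> \<beta> \<gamma> (\<delta> + 6)
     + fps_X ^ 2 * (qconst ^ (\<delta> + 3) * dilate (dilate (quadruple_series \<alpha> \<beta> \<gamma> \<delta>)))"
proof -
  have "quadruple_series \<alpha> \<beta> \<gamma> \<delta> - quadruple_series \<alpha> \<beta> \<gamma> (\<delta> + 6)
      = fps_X ^ 2 * (fps_const (fps_X ^ (\<delta> + 3)) * quadruple_series (\<alpha> + 3 + 3) (\<beta> + 3 + 3) (\<gamma> + 3 + 3) (\<delta> + 6 + 6))"
    unfolding quadruple_series_def sum_by_diff
  proof (rule sum_by_reindex[where \<phi> = "\<lambda>(i, j, k, l). (i, j, k, Suc l)"], goal_cases)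
    case (3 p)
    obtain i j k l where p: "p = (i, j, k, l)" by (cases p) auto
    show ?case
      unfolding p prod.case
      by (rule inv_qpoch_step[where k = 6 and n = l and g = "inv_qpoch 3 i * inv_qpoch 3 j * inv_qpoch 3 k"])
         (simp_all add: choose_2_Suc algebra_simps)
  next
    case (4 p)
    obtain i j k l where "p = (i, j, k, l)" by (cases p) auto
    with 4 show ?case by (cases l) (auto simp: image_iff)
  qed (auto intro!: injI finite_quadruple_weight)
  then show ?thesis
   
    unfolding fps_const_X_power dilate_quadruple_series power_one_right by (rule eq_add_if_diff_eq)
qed

lemma quadruple_series_nth_0: "quadruple_series \<alpha> \<beta> \<gamma> \<delta> $ 0 = 1"
proof -
  have "{p. (case p of (i, j, k, l) \<Rightarrow> i + j + k + 2 * l) = (0::nat)} = {(0, 0, 0, 0)}" by auto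
  then show ?thesis
    by (simp add: quadruple_series_def sum_by_def inv_qpoch_def qpoch_def binomial_eq_0)
qed

text \<open>The factors of the product are stripped off one at a time; \<open>h\<close> below corresponds to the product
  without its two denominators, and is computed from both ends.\<close>
lemma quadruple_series_third_order:
  defines "t \<equiv> quadruple_series 3 5 1 3"
  shows "t = (fps_X * (qconst ^ 3 * dilate t) + fps_X * (fps_X * (qconst ^ 6 * dilate (dilate t)))
         - fps_X * (fps_X * (fps_X * (qconst ^ 15 * dilate (dilate (dilate t))))))
       + (dilate t + fps_X * (qconst * dilate (dilate t)) + fps_X * (qconst ^ 5 * dilate (dilate t))
         + fps_X * (fps_X * (qconst ^ 9 * dilate (dilate (dilate t)))))"
proof -
  define p h w where "p = quadruple_series 3 5 1 9" "h = quadruple_series 6 5 1 9"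
    "w = quadruple_series 6 8 1 9"
  note defs = p_h_w_def
  have t: "t = p + fps_X ^ 2 * (qconst ^ 6 * dilate (dilate t))"
    using quadruple_series_step_l[of 3 5 1 3] by (simp add: t_def defs)
  have p: "p = h + fps_X * (qconst ^ 3 * dilate p)"
    using quadruple_series_step_i[of 3 5 1 9] by (simp add: defs)
  have h: "h = w + fps_X * (qconst ^ 5 * dilate w)"
    using quadruple_series_step_j[of 6 5 1 9] by (simp add: defs)
  \<comment> \<open>One step in each of the four parameters amounts to a dilation, which closes the
    chain.\<close>
  have "quadruple_series 6 8 4 9 = dilate t"
    by (simp add: t_def dilate_quadruple_series)
  then have w: "w = dilate t + fps_X * (qconst * dilate (dilate t))"
    using quadruple_series_step_k[of 6 8 1 9] by (simp add: defs)
  have dp: "dilate p = dilate t - (qconst ^ 3 * fps_X) ^ 2 * (qconst ^ 6 * dilate (dilate (dilate t)))"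
    using arg_cong[OF t, of dilate] unfolding dilate_simps by algebra
  have dw: "dilate w = dilate (dilate t) + qconst ^ 3 * fps_X * (qconst * dilate (dilate (dilate t)))"
    using arg_cong[OF w, of dilate] by (simp add: dilate_simps)
  show ?thesis using t p h w dp dw by algebra
qed

text \<open>Each equation is a path of contiguous relations between parameter pairs, a dilation
  being the shift by (3, 6). The shape of the equations is that of
  \<open>count_series_system\<close>.\<close>

lemma double_series_system:
  defines "a \<equiv> double_series 0 0" and "b \<equiv> double_series 1 3"
  shows "a = b + fps_X * (qconst ^ 2 * dilate b) + fps_X * (fps_X * (qconst ^ 6 * dilate (dilate a)))"
    and "b = dilate a + fps_X * (qconst ^ 4 * dilate (dilate a)) + fps_X * (qconst ^ 3 * dilate b)"
    and "double_series 1 0 + fps_X * (qconst * double_series 4 6) = b + fps_X * (qconst * dilate a)"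
proof -
  have d: "dilate a = double_series 3 6" "dilate (double_series 3 6) = double_series 6 12"
    "dilate b = double_series 4 9"
    by (simp_all add: a_def b_def dilate_double_series)
  show "a = b + fps_X * (qconst ^ 2 * dilate b) + fps_X * (fps_X * (qconst ^ 6 * dilate (dilate a)))"
  proof -
    have "double_series 0 0 = double_series 0 3 + fps_X ^ 2 * (qconst ^ 6 * double_series 6 12)"
      using double_series_step_j[of 0 0] by simp
    moreover have "double_series 0 3 = double_series 1 3 + fps_X * (qconst ^ 2 * double_series 4 9)"
      using double_series_step_i[of 0 3] by (simp del: One_nat_def add: numeral_2_eq_2[symmetric])
    ultimately show ?thesis unfolding d unfolding a_def b_def by algebra
  qed
  \<comment> \<open>\<open>e1\<close> to \<open>e4\<close> expand the left side, \<open>e5\<close>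
    and \<open>e6\<close> the term \<open>dilate b\<close> on the right; the two sides then agree
    term by term.\<close>
  have e1: "double_series 1 3 = double_series 2 3 + fps_X * (qconst ^ 3 * double_series 5 9)"
    using double_series_step_i[of 1 3] by (simp del: One_nat_def)
  have e2: "double_series 2 3 = double_series 3 3 + fps_X * (qconst ^ 4 * double_series 6 9)"
    using double_series_step_i[of 2 3] by simp
  have e3: "double_series 3 3 = double_series 3 6 + fps_X ^ 2 * (qconst ^ 9 * double_series 9 15)"
    using double_series_step_j[of 3 3] by simp
  have e4: "double_series 6 9 = double_series 6 12 + fps_X ^ 2 * (qconst ^ 15 * double_series 12 21)"
    using double_series_step_j[of 6 9] by simp
  have e5: "double_series 4 9 = double_series 5 9 + fps_X * (qconst ^ 6 * double_series 8 15)"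
    using double_series_step_i[of 4 9] by simp
  have e6: "double_series 8 15 = double_series 9 15 + fps_X * (qconst ^ 10 * double_series 12 21)"
    using double_series_step_i[of 8 15] by simp
  show "b = dilate a + fps_X * (qconst ^ 4 * dilate (dilate a)) + fps_X * (qconst ^ 3 * dilate b)"
    unfolding d unfolding b_def unfolding e1 e2 e3 e4 e5 e6 by algebra
  \<comment> \<open>S(1, 0) and S(4, 6) are both compared with their neighbours through S(7, 12),
    whose two contributions x^2 q^6 S(7, 12) cancel.\<close>
  have "double_series 1 0 = double_series 1 3 + fps_X ^ 2 * (qconst ^ 6 * double_series 7 12)"
    using double_series_step_j[of 1 0] by simp
  moreover have "double_series 3 6 = double_series 4 6 + fps_X * (qconst ^ 5 * double_series 7 12)"
    using double_series_step_i[of 3 6] by simp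
  ultimately show "double_series 1 0 + fps_X * (qconst * double_series 4 6) = b + fps_X * (qconst * dilate a)"
    unfolding d unfolding b_def by algebra
qed

section \<open>Partitions\<close>

definition count_series :: "nat list set \<Rightarrow> rat fps fps" where
  "count_series A = Abs_fps (\<lambda>n. Abs_fps (\<lambda>N. of_nat (card {\<pi>\<in>A. length \<pi> = n \<and> sum_list \<pi> = N})))"

lemma count_series_nth [simp]:
  "count_series A $ n $ N = of_nat (card {\<pi>\<in>A. length \<pi> = n \<and> sum_list \<pi> = N})"
  by (simp add: count_series_def)

lemma finite_length_sum_list: "finite {\<pi>\<in>A. length \<pi> = n \<and> sum_list \<pi> = (N::nat)}"
  by (rule finite_subset[OF _ finite_lists_length_eq[of "{..N}" n]])
     (auto intro: member_le_sum_list)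

lemma count_series_Un:
  assumes "A \<inter> B = {}"
  shows "count_series (A \<union> B) = count_series A + count_series B"
proof (rule fps_fps_eqI)
  fix n N
  have "{\<pi>\<in>A \<union> B. length \<pi> = n \<and> sum_list \<pi> = N}
      = {\<pi>\<in>A. length \<pi> = n \<and> sum_list \<pi> = N} \<union> {\<pi>\<in>B. length \<pi> = n \<and> sum_list \<pi> = N}"
    by auto
  then show "count_series (A \<union> B) $ n $ N = (count_series A + count_series B) $ n $ N"
    using assms by (simp add: card_Un_disjoint finite_length_sum_list disjoint_iff)
qed

lemma count_series_Cons: "count_series (Cons m ` A) = fps_X * (qconst ^ m * count_series A)"
proof (rule fps_fps_eqI)
  fix n N
  show "count_series (Cons m ` A) $ n $ N = (fps_X * (qconst ^ m * count_series A)) $ n $ N"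
  proof (cases n)
    case 0
    then have "{\<pi> \<in> Cons m ` A. length \<pi> = n \<and> sum_list \<pi> = N} = {}" by auto
    with 0 show ?thesis by simp
  next
    case (Suc k)
    have "{\<pi> \<in> Cons m ` A. length \<pi> = n \<and> sum_list \<pi> = N}
        = Cons m ` {\<pi>\<in>A. length \<pi> = k \<and> m + sum_list \<pi> = N}"
      using Suc by auto
    also have "card \<dots> = card {\<pi>\<in>A. length \<pi> = k \<and> m + sum_list \<pi> = N}"
      by (rule card_image) simp
    also have "{\<pi>\<in>A. length \<pi> = k \<and> m + sum_list \<pi> = N}
        = (if N < m then {} else {\<pi>\<in>A. length \<pi> = k \<and> sum_list \<pi> = N - m})"
      by auto
    finally show ?thesis
      using Suc by (simp add: fps_X_power_mult_nth flip: fps_const_X_power)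
  qed
qed

lemma sum_list_map_add: "sum_list (map (\<lambda>p. p + c) \<pi>) = c * length \<pi> + sum_list \<pi>" for c :: nat
  by (induction \<pi>) simp_all

lemma count_series_map_add_3: "count_series (map (\<lambda>p. p + 3) ` A) = dilate (count_series A)"
proof (rule fps_fps_eqI)
  fix n N
  have "{\<pi> \<in> map (\<lambda>p. p + 3) ` A. length \<pi> = n \<and> sum_list \<pi> = N}
      = map (\<lambda>p. p + 3) ` {\<pi>\<in>A. length \<pi> = n \<and> 3 * n + sum_list \<pi> = N}"
    by (auto simp: sum_list_map_add)
  also have "card \<dots> = card {\<pi>\<in>A. length \<pi> = n \<and> 3 * n + sum_list \<pi> = N}"
    by (rule card_image) (simp add: inj_on_subset[OF inj_mapI[of "\<lambda>p. p + 3"]] inj_def)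
  also have "{\<pi>\<in>A. length \<pi> = n \<and> 3 * n + sum_list \<pi> = N}
      = (if N < 3 * n then {} else {\<pi>\<in>A. length \<pi> = n \<and> sum_list \<pi> = N - 3 * n})"
    by auto
  finally show "count_series (map (\<lambda>p. p + 3) ` A) $ n $ N = dilate (count_series A) $ n $ N"
    by (simp add: fps_X_power_mult_nth)
qed

text \<open>Parts are positive, so the number of parts is at most their sum; hence each power of q
  receives finitely many partitions.\<close>

lemma has_sum_count_series:
  assumes "A \<subseteq> partitions"
  shows "((\<lambda>\<pi>. var_x ^ length \<pi> * var_q ^ sum_list \<pi>) has_sum swap_vars (count_series A)) A"
proof -
  have fin: "finite {\<pi>\<in>A. sum_list \<pi> = N}" for N
  proof (rule finite_subset)
    have "length \<pi> \<le> sum_list \<pi>" if "\<forall>p\<in>set \<pi>. 0 < p" for \<pi> :: "nat list"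
      using that by (induction \<pi>) auto
    then show "{\<pi>\<in>A. sum_list \<pi> = N} \<subseteq> {\<pi>. set \<pi> \<subseteq> {..N} \<and> length \<pi> \<le> N}"
      using assms by (auto simp: partitions_def intro: member_le_sum_list)
  qed (rule finite_lists_length_le, simp)
  have nz: "{\<pi>. P \<pi> \<and> (fps_X ^ sum_list \<pi> :: rat fps) $ N \<noteq> 0} = {\<pi>. P \<pi> \<and> sum_list \<pi> = N}" for P N
    by auto
  have "((\<lambda>\<pi>. swap_vars (fps_X ^ length \<pi> * fps_const (fps_X ^ sum_list \<pi>)))
      has_sum swap_vars (count_series A)) A"
  proof (rule has_sum_swap_vars)
    fix n N
    have "{\<pi>. \<pi> \<in> A \<and> length \<pi> = n \<and> (fps_X ^ sum_list \<pi> :: rat fps) $ N \<noteq> 0}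
        = {\<pi>\<in>A. length \<pi> = n \<and> sum_list \<pi> = N}" by auto
    then show "count_series A $ n $ N
        = (\<Sum>\<pi> | \<pi> \<in> A \<and> length \<pi> = n \<and> fps_X ^ sum_list \<pi> $ N \<noteq> (0::rat). fps_X ^ sum_list \<pi> $ N)"
      by simp
  qed (simp only: nz fin)
  then show ?thesis
    by (simp only: swap_vars_mult swap_vars_power swap_vars_X fps_const_X_power qconst_def
          swap_vars_const_X)
qed

section \<open>Recursive structure of C: the smallest part and the shift by 3\<close>

lemma C_parts_Cons:
  "m # \<pi> \<in> C_parts \<longleftrightarrow> 0 < m \<and> \<pi> \<in> C_parts \<and>
     (\<pi> = [] \<or> m + 2 \<le> hd \<pi> \<and> (hd \<pi> \<in> {m + 2, m + 3} \<longrightarrow> 3 dvd m + hd \<pi>))"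
proof -
  \<comment> \<open>Splitting off position 0 separates the condition on the first two parts from
    those on the tail.\<close>
  have "(\<forall>i. P i) \<longleftrightarrow> P 0 \<and> (\<forall>i. P (Suc i))" for P :: "nat \<Rightarrow> bool"
    by (metis nat.exhaust)
  note all = this[of "\<lambda>i. Suc i < length (m # \<pi>) \<longrightarrow> Q i" for Q]
  \<comment> \<open>Truncated subtraction is harmless here, since all the differences tested are
    positive.\<close>
  have eq: "n - m \<in> {2, 3} \<longleftrightarrow> n \<in> {m + 2, m + 3}" "2 \<le> n - m \<longleftrightarrow> m + 2 \<le> n" for n
    by auto
  show ?thesis
    unfolding C_parts_def partitions_def mem_Collect_eq all
    by (cases \<pi>) (auto simp: eq simp del: insert_iff)
qed

definition C_parts_ge :: "nat \<Rightarrow> nat list set" where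
  "C_parts_ge k = {\<pi>\<in>C_parts. \<forall>p\<in>set \<pi>. k \<le> p}"

lemma Nil_in_C_parts [simp]: "[] \<in> C_parts"
  by (simp add: C_parts_def partitions_def)

lemma C_parts_sorted: "\<pi> \<in> C_parts \<Longrightarrow> sorted \<pi>"
  by (simp add: C_parts_def partitions_def)

text \<open>Members of C are sorted, so a lower bound need only be tested on the first part.\<close>

lemma mem_C_parts_ge: "\<pi> \<in> C_parts_ge k \<longleftrightarrow> \<pi> \<in> C_parts \<and> (\<pi> = [] \<or> k \<le> hd \<pi>)"
  using C_parts_sorted[of \<pi>] by (cases \<pi>) (auto simp: C_parts_ge_def intro: order_trans)

lemma C_parts_ge_split:
  assumes "m > 0"
  shows "C_parts_ge m = C_parts_ge (Suc m) \<union> Cons m ` {\<pi>. m # \<pi> \<in> C_parts}"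
    and "C_parts_ge (Suc m) \<inter> Cons m ` {\<pi>. m # \<pi> \<in> C_parts} = {}"
proof -
  show "C_parts_ge m = C_parts_ge (Suc m) \<union> Cons m ` {\<pi>. m # \<pi> \<in> C_parts}"
  proof (rule set_eqI)
    fix \<pi>
    show "\<pi> \<in> C_parts_ge m \<longleftrightarrow> \<pi> \<in> C_parts_ge (Suc m) \<union> Cons m ` {\<pi>. m # \<pi> \<in> C_parts}"
    proof (cases \<pi>)
      case (Cons p \<rho>)
      then show ?thesis by (cases "p = m") (auto simp: mem_C_parts_ge)
    qed (auto simp: mem_C_parts_ge)
  qed
qed (auto simp: mem_C_parts_ge)

lemma count_series_split:
  "m > 0 \<Longrightarrow> count_series (C_parts_ge m) = count_series (C_parts_ge (Suc m))
     + fps_X * (qconst ^ m * count_series {\<pi>. m # \<pi> \<in> C_parts})"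
  by (simp only: C_parts_ge_split(1)[of m] count_series_Un[OF C_parts_ge_split(2)] count_series_Cons)

text \<open>The residue of the smallest part m mod 3 decides what may follow: at least m + 3 for
  residue 0, at least m + 4 for residue 1. For residue 2 it is m + 2 or at least m + 4, so a 2 can
  be followed by a 4, which is split off separately.\<close>

lemma C_parts_followers:
  "{\<pi>. 1 # \<pi> \<in> C_parts} = C_parts_ge 5"
  "{\<pi>. 2 # \<pi> \<in> C_parts} = C_parts_ge 6 \<union> Cons 4 ` {\<pi>. 4 # \<pi> \<in> C_parts}"
  "C_parts_ge 6 \<inter> Cons 4 ` {\<pi>. 4 # \<pi> \<in> C_parts} = {}"
  "{\<pi>. 3 # \<pi> \<in> C_parts} = C_parts_ge 6"
  "{\<pi>. 4 # \<pi> \<in> C_parts} = C_parts_ge 8"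
proof -
  have ev: "m + 2 \<le> n \<and> (n \<in> {m + 2, m + 3} \<longrightarrow> 3 dvd m + n) \<longleftrightarrow>
     (if m mod 3 = 0 then m + 3 \<le> n else if m mod 3 = 1 then m + 4 \<le> n else n = m + 2 \<or> m + 4 \<le> n)"
    for m n :: nat
    by (simp split: if_splits; presburger)
  have r: "m # \<pi> \<in> C_parts \<longleftrightarrow> 0 < m \<and> \<pi> \<in> C_parts \<and> (\<pi> = [] \<or>
     (if m mod 3 = 0 then m + 3 \<le> hd \<pi> else if m mod 3 = 1 then m + 4 \<le> hd \<pi>
      else hd \<pi> = m + 2 \<or> m + 4 \<le> hd \<pi>))" for m \<pi>
    by (simp only: C_parts_Cons ev)
  show "{\<pi>. 1 # \<pi> \<in> C_parts} = C_parts_ge 5"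
    "{\<pi>. 3 # \<pi> \<in> C_parts} = C_parts_ge 6"
    "{\<pi>. 4 # \<pi> \<in> C_parts} = C_parts_ge 8"
    by (auto simp: r mem_C_parts_ge)
  show "{\<pi>. 2 # \<pi> \<in> C_parts} = C_parts_ge 6 \<union> Cons 4 ` {\<pi>. 4 # \<pi> \<in> C_parts}"
  proof (rule set_eqI)
    fix \<pi>
    show "\<pi> \<in> {\<pi>. 2 # \<pi> \<in> C_parts} \<longleftrightarrow> \<pi> \<in> C_parts_ge 6 \<union> Cons 4 ` {\<pi>. 4 # \<pi> \<in> C_parts}"
      by (cases \<pi>) (auto simp: r[of 2] mem_C_parts_ge image_iff)
  qed
  show "C_parts_ge 6 \<inter> Cons 4 ` {\<pi>. 4 # \<pi> \<in> C_parts} = {}"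
    by (auto simp: mem_C_parts_ge)
qed

text \<open>The shift keeps all differences and changes the sum of two adjacent parts by 6, so
  divisibility by 3 is unaffected.\<close>

lemma map_add_3_in_C_parts:
  assumes "\<forall>p\<in>set \<pi>. 0 < p"
  shows "map (\<lambda>p. p + 3) \<pi> \<in> C_parts \<longleftrightarrow> \<pi> \<in> C_parts"
  using assms
proof (induction \<pi>)
  case (Cons m \<pi>)
  have "m + 3 + 2 \<le> n + 3 \<and> (n + 3 \<in> {m + 3 + 2, m + 3 + 3} \<longrightarrow> 3 dvd m + 3 + (n + 3))
      \<longleftrightarrow> m + 2 \<le> n \<and> (n \<in> {m + 2, m + 3} \<longrightarrow> 3 dvd m + n)" for n :: nat
    unfolding insert_iff empty_iff by presburger
  with Cons show ?case
    unfolding list.map(2) C_parts_Cons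
    by (cases "\<pi> = []") (simp_all only: hd_map list.map_disc_iff list.set_intros simp_thms, simp_all)
qed simp

lemma C_parts_ge_add_3:
  assumes "k > 0"
  shows "C_parts_ge (k + 3) = map (\<lambda>p. p + 3) ` C_parts_ge k"
proof
  show "C_parts_ge (k + 3) \<subseteq> map (\<lambda>p. p + 3) ` C_parts_ge k"
  proof
    fix \<pi> assume \<pi>: "\<pi> \<in> C_parts_ge (k + 3)"
    \<comment> \<open>All parts are at least k + 3, so this subtraction is exact and leaves parts at
      least k > 0.\<close>
    define \<rho> where "\<rho> = map (\<lambda>p. p - 3) \<pi>"
    have eq: "\<pi> = map (\<lambda>p. p + 3) \<rho>"
    proof -
      have "\<forall>p\<in>set \<pi>. p - 3 + 3 = p"
        using \<pi> by (force simp: C_parts_ge_def)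
      then show ?thesis by (simp add: \<rho>_def comp_def map_idI)
    qed
    have "\<forall>p\<in>set \<rho>. k \<le> p"
      using \<pi> by (force simp: \<rho>_def C_parts_ge_def)
    moreover from this assms have "\<forall>p\<in>set \<rho>. 0 < p" by fastforce
    ultimately have "\<rho> \<in> C_parts_ge k"
      using map_add_3_in_C_parts[of \<rho>] \<pi> eq by (auto simp: C_parts_ge_def)
    with eq show "\<pi> \<in> map (\<lambda>p. p + 3) ` C_parts_ge k" by blast
  qed
  show "map (\<lambda>p. p + 3) ` C_parts_ge k \<subseteq> C_parts_ge (k + 3)"
  proof
    fix \<pi> assume "\<pi> \<in> map (\<lambda>p. p + 3) ` C_parts_ge k"
    then obtain \<rho> where \<rho>: "\<pi> = map (\<lambda>p. p + 3) \<rho>" "\<rho> \<in> C_parts_ge k" by blast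
    then have "\<forall>p\<in>set \<rho>. 0 < p" using assms by (auto simp: C_parts_ge_def)
    with \<rho> show "\<pi> \<in> C_parts_ge (k + 3)"
      using map_add_3_in_C_parts[of \<rho>] by (auto simp: C_parts_ge_def)
  qed
qed

lemma count_series_C_parts_ge_add_3:
  "k > 0 \<Longrightarrow> count_series (C_parts_ge (k + 3)) = dilate (count_series (C_parts_ge k))"
  by (simp only: C_parts_ge_add_3 count_series_map_add_3)

lemma P1_eq: "P1 = C_parts_ge 2"
proof (rule set_eqI)
  fix \<pi> :: "nat list"
  have "1 \<notin> set \<pi> \<longleftrightarrow> (\<forall>p\<in>set \<pi>. 2 \<le> p)" if "\<forall>p\<in>set \<pi>. 0 < p"
  proof -
    have "2 \<le> p \<longleftrightarrow> p \<noteq> 1" if "0 < p" for p :: nat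
      using that by linarith
    with that show ?thesis by metis
  qed
  then show "\<pi> \<in> P1 \<longleftrightarrow> \<pi> \<in> C_parts_ge 2"
    by (auto simp: P1_def C_parts_ge_def C_parts_def partitions_def)
qed

text \<open>Without 2 the smallest part is 1 or at least 3, and what follows a 1 is at least 5,
  which excludes 2 by itself.\<close>

lemma P2_eq: "P2 = C_parts_ge 3 \<union> Cons 1 ` C_parts_ge 5"
proof (rule set_eqI)
  fix \<pi>
  show "\<pi> \<in> P2 \<longleftrightarrow> \<pi> \<in> C_parts_ge 3 \<union> Cons 1 ` C_parts_ge 5"
  proof (cases \<pi>)
    case Nil
    then show ?thesis by (simp add: P2_def mem_C_parts_ge)
  next
    case (Cons m \<rho>)
    have pos: "m > 0" if "\<pi> \<in> C_parts" using that Cons by (simp add: C_parts_Cons)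
    consider "m = 0" | "m = 1" | "m = 2" | "m \<ge> 3" by linarith
    then show ?thesis
    proof cases
      case 1
      then show ?thesis using pos Cons by (auto simp: P2_def mem_C_parts_ge)
    next
      case 2
      have "2 \<notin> set \<rho>" if "\<rho> \<in> C_parts_ge 5" using that by (auto simp: C_parts_ge_def)
      with 2 Cons C_parts_followers(1) show ?thesis
        by (auto simp: P2_def mem_C_parts_ge)
    next
      case 3
      then show ?thesis using Cons by (auto simp: P2_def mem_C_parts_ge)
    next
      case 4
      have "2 \<notin> set \<pi>" if "\<pi> \<in> C_parts_ge 3" using that by (auto simp: C_parts_ge_def)
      with 4 Cons show ?thesis
        by (auto simp: P2_def mem_C_parts_ge)
    qed
  qed
qed

lemma count_series_system:
  defines "a \<equiv> count_series (C_parts_ge 2)" and "b \<equiv> count_series (C_parts_ge 3)"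
  shows "a = b + fps_X * (qconst ^ 2 * dilate b) + fps_X * (fps_X * (qconst ^ 6 * dilate (dilate a)))"
    and "b = dilate a + fps_X * (qconst ^ 4 * dilate (dilate a)) + fps_X * (qconst ^ 3 * dilate b)"
    and "count_series P2 = b + fps_X * (qconst * dilate a)"
proof -
  \<comment> \<open>The generating function of all of C. It enters through the parts at least 4,
    which are its dilation, and is eliminated by removing a smallest part 1.\<close>
  define c where "c = count_series (C_parts_ge 1)"
  have d: "count_series (C_parts_ge 5) = dilate a" "count_series (C_parts_ge 6) = dilate b"
    "count_series (C_parts_ge 4) = dilate c"
    using count_series_C_parts_ge_add_3[of 2] count_series_C_parts_ge_add_3[of 3]
      count_series_C_parts_ge_add_3[of 1] by (simp_all add: a_def b_def c_def)
  have d8: "count_series (C_parts_ge 8) = dilate (dilate a)"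
    using count_series_C_parts_ge_add_3[of 5] d by simp
  have c: "c = a + fps_X * (qconst * dilate a)"
    using count_series_split[of 1] C_parts_followers(1) d by (simp add: c_def a_def numeral_2_eq_2)
  have "count_series {\<pi>. 2 # \<pi> \<in> C_parts} = dilate b + fps_X * (qconst ^ 4 * dilate (dilate a))"
    unfolding C_parts_followers(2) count_series_Un[OF C_parts_followers(3)] count_series_Cons
    by (simp add: d d8 C_parts_followers(5))
  with count_series_split[of 2]
  have "a = b + fps_X * (qconst ^ 2 * (dilate b + fps_X * (qconst ^ 4 * dilate (dilate a))))"
    by (simp add: a_def b_def)
  then show "a = b + fps_X * (qconst ^ 2 * dilate b) + fps_X * (fps_X * (qconst ^ 6 * dilate (dilate a)))"
    by algebra
  have "b = dilate c + fps_X * (qconst ^ 3 * dilate b)"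
    using count_series_split[of 3] by (simp add: b_def[symmetric] d C_parts_followers(4))
  moreover have "dilate c = dilate a + qconst ^ 3 * fps_X * (qconst * dilate (dilate a))"
    using arg_cong[OF c, of dilate] by (simp add: dilate_simps)
  ultimately show "b = dilate a + fps_X * (qconst ^ 4 * dilate (dilate a)) + fps_X * (qconst ^ 3 * dilate b)"
    by algebra
  have "C_parts_ge 3 \<inter> Cons 1 ` C_parts_ge 5 = {}"
    by (auto simp: mem_C_parts_ge)
  from count_series_Un[OF this] show "count_series P2 = b + fps_X * (qconst * dilate a)"
    by (simp add: P2_eq count_series_Cons b_def d flip: One_nat_def)
qed

lemma count_series_nth_0: "[] \<in> A \<Longrightarrow> count_series A $ 0 = 1"
proof (rule fps_ext)
  fix N
  assume "[] \<in> A"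
  then have "{\<pi>\<in>A. length \<pi> = 0 \<and> sum_list \<pi> = N} = (if N = 0 then {[]} else {})" by auto
  then show "count_series A $ 0 $ N = 1 $ N" by (simp add: fps_one_nth)
qed

section \<open>Comparison\<close>

text \<open>The system is linear and homogeneous, so the difference of its two solutions solves it
  too; their constant terms in x are both 1.\<close>

lemma double_series_solution:
  "count_series (C_parts_ge 2) = double_series 0 0" "count_series (C_parts_ge 3) = double_series 1 3"
proof -
  let ?a = "count_series (C_parts_ge 2)" and ?b = "count_series (C_parts_ge 3)"
    and ?a' = "double_series 0 0" and ?b' = "double_series 1 3"
  have "?a - ?a' = 0 \<and> ?b - ?b' = 0"
  proof (rule system_zero)
    show "?a - ?a' = ?b - ?b' + fps_X * (qconst ^ 2 * dilate (?b - ?b'))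
        + fps_X * (fps_X * (qconst ^ 6 * dilate (dilate (?a - ?a'))))"
      by (subst count_series_system(1), subst double_series_system(1))
         (simp add: dilate_diff algebra_simps)
    show "?b - ?b' = dilate (?a - ?a') + fps_X * (qconst ^ 4 * dilate (dilate (?a - ?a')))
        + fps_X * (qconst ^ 3 * dilate (?b - ?b'))"
      by (subst count_series_system(2), subst double_series_system(2))
         (simp add: dilate_diff algebra_simps)
    show "(?a - ?a') $ 0 = 0"
      by (simp add: count_series_nth_0 mem_C_parts_ge double_series_nth_0)
  qed
  then show "?a = ?a'" "?b = ?b'" by simp_all
qed

lemma count_series_P2_double:
  "count_series P2 = double_series 1 0 + fps_X * (qconst * double_series 4 6)"
  by (simp only: count_series_system(3) double_series_system(3) double_series_solution)

text \<open>Both sides satisfy the third-order equation, one by elimination and one by its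
  contiguous relations, and both have constant term 1 in x.\<close>

lemma count_series_P2_quadruple: "count_series P2 = quadruple_series 3 5 1 3"
proof -
  let ?g = "count_series P2" and ?t = "quadruple_series 3 5 1 3"
  note g = system_third_order[OF count_series_system]
  have "?g - ?t = 0"
  proof (rule third_order_zero)
    show "?g - ?t = (fps_X * (qconst ^ 3 * dilate (?g - ?t))
           + fps_X * (fps_X * (qconst ^ 6 * dilate (dilate (?g - ?t))))
           - fps_X * (fps_X * (fps_X * (qconst ^ 15 * dilate (dilate (dilate (?g - ?t)))))))
         + (dilate (?g - ?t) + fps_X * (qconst * dilate (dilate (?g - ?t)))
           + fps_X * (qconst ^ 5 * dilate (dilate (?g - ?t)))
           + fps_X * (fps_X * (qconst ^ 9 * dilate (dilate (dilate (?g - ?t))))))"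
      by (subst g, subst quadruple_series_third_order) (simp add: dilate_diff algebra_simps)
    show "(?g - ?t) $ 0 = 0"
      by (simp add: count_series_nth_0 P2_def quadruple_series_nth_0)
  qed
  then show ?thesis by simp
qed

section \<open>Return to q as outer variable: denominators and convergence\<close>

definition embed_q :: "rat fps \<Rightarrow> rat fps fps" where
  "embed_q c = swap_vars (fps_const c)"

lemma embed_q_mult: "embed_q (c * d) = embed_q c * embed_q d"
  unfolding embed_q_def swap_vars_mult[symmetric] fps_const_mult ..

lemma embed_q_X_power: "embed_q (fps_X ^ n) = var_q ^ n"
  by (simp only: embed_q_def fps_const_X_power qconst_def swap_vars_power swap_vars_const_X)

lemma swap_vars_X_power: "swap_vars (fps_X ^ n * fps_const c) = var_x ^ n * embed_q c"
  by (simp only: embed_q_def swap_vars_mult swap_vars_power swap_vars_X)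

lemma qpoch_mult_embed_q:
  assumes "k > 0"
  shows "qpoch (var_q ^ k) (var_q ^ k) n * embed_q (inv_qpoch k n) = 1"
proof -
  have "qpoch (var_q ^ k) (var_q ^ k) n = embed_q (qpoch (fps_X ^ k) (fps_X ^ k) n)"
    by (simp only: embed_q_def swap_vars_qpoch) (simp only: embed_q_X_power flip: embed_q_def)
  then show ?thesis
    using assms by (simp only: embed_q_mult[symmetric] mult.commute[of "qpoch _ _ _"] inv_qpoch_mult)
       (simp add: embed_q_def)
qed

text \<open>With constant term 1 the division is a true quotient, so any explicit inverse
  \<open>h\<close> of the denominator computes it.\<close>

lemma fps_divide_eq_mult:
  fixes f g h :: "rat fps fps"
  assumes "g $ 0 = 1" and "g * h = 1"
  shows "f / g = f * h"
proof -
  have "f / g = f / g * (g * h)" by (simp add: assms(2))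
  also have "\<dots> = f * h" by (simp add: fps_fps_divide_mult[OF assms(1)] flip: mult.assoc)
  finally show ?thesis .
qed

lemma divide_double_denominator:
  "f / (qpoch var_q var_q i * qpoch (var_q ^ 3) (var_q ^ 3) j)
     = f * embed_q (inv_qpoch 1 i * inv_qpoch 3 j)"
proof (rule fps_divide_eq_mult)
  show "(qpoch var_q var_q i * qpoch (var_q ^ 3) (var_q ^ 3) j) $ 0 = 1"
    using fps_nth_qpoch_0[of 1 i] fps_nth_qpoch_0[of 3 j] by simp
  show "qpoch var_q var_q i * qpoch (var_q ^ 3) (var_q ^ 3) j * embed_q (inv_qpoch 1 i * inv_qpoch 3 j) = 1"
    \<comment> \<open>\<open>num.Bit1 num.One\<close> is the binary numeral 3.\<close>
    using qpoch_mult_embed_q[OF zero_less_one, of i] qpoch_mult_embed_q[OF zero_less_numeral, of "num.Bit1 num.One" j]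
    unfolding embed_q_mult power_one_right by algebra
qed

lemma divide_quadruple_denominator:
  "f / (qpoch (var_q ^ 3) (var_q ^ 3) i * qpoch (var_q ^ 3) (var_q ^ 3) j
        * qpoch (var_q ^ 3) (var_q ^ 3) k * qpoch (var_q ^ 6) (var_q ^ 6) l)
     = f * embed_q (inv_qpoch 3 i * inv_qpoch 3 j * inv_qpoch 3 k * inv_qpoch 6 l)"
proof (rule fps_divide_eq_mult)
  let ?p = "\<lambda>k. qpoch (var_q ^ k) (var_q ^ k)" and ?e = "\<lambda>k n. embed_q (inv_qpoch k n)"
  show "(?p 3 i * ?p 3 j * ?p 3 k * ?p 6 l) $ 0 = 1"
    by (simp add: fps_nth_qpoch_0)
  have "?p 3 i * ?p 3 j * ?p 3 k * ?p 6 l * embed_q (inv_qpoch 3 i * inv_qpoch 3 j * inv_qpoch 3 k * inv_qpoch 6 l)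
      = (?p 3 i * ?e 3 i) * (?p 3 j * ?e 3 j) * (?p 3 k * ?e 3 k) * (?p 6 l * ?e 6 l)"
    unfolding embed_q_mult by (simp only: mult_ac)
  also have "\<dots> = 1"
    by (simp only: qpoch_mult_embed_q zero_less_numeral mult_1_right)
  finally show "?p 3 i * ?p 3 j * ?p 3 k * ?p 6 l
      * embed_q (inv_qpoch 3 i * inv_qpoch 3 j * inv_qpoch 3 k * inv_qpoch 6 l) = 1" .
qed

lemma finite_double_exponent:
  "finite {p. (case p of (i, j) \<Rightarrow> 2 * i^2 + 6 * i * j + 6 * j^2 + u * i + v * j) \<le> (N::nat)}"
proof (rule finite_subset)
  show "{p. (case p of (i, j) \<Rightarrow> 2 * i^2 + 6 * i * j + 6 * j^2 + u * i + v * j) \<le> N} \<subseteq> {..N} \<times> {..N}"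
  proof clarify
    fix i j :: nat
    assume "2 * i^2 + 6 * i * j + 6 * j^2 + u * i + v * j \<le> N"
    moreover have "i \<le> i^2" "j \<le> j^2" by (simp_all add: power2_eq_square)
    ultimately show "i \<in> {..N} \<and> j \<in> {..N}" by simp
  qed
qed simp

lemma has_sum_double_series:
  "((\<lambda>(i, j). var_x ^ (i + 2 * j) * var_q ^ (2 * i^2 + 6 * i * j + 6 * j^2 + u * i + v * j)
      / (qpoch var_q var_q i * qpoch (var_q ^ 3) (var_q ^ 3) j))
    has_sum swap_vars (double_series u v)) UNIV"
proof -
  let ?e = "\<lambda>(i, j). 2 * i^2 + 6 * i * j + 6 * j^2 + u * i + v * j"
  from has_sum_sum_by[where e = ?e, OF finite_double_weight finite_double_exponent,
      of "\<lambda>(i, j). fps_X ^ ?e (i, j) * (inv_qpoch 1 i * inv_qpoch 3 j)"]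
  show ?thesis
    unfolding divide_double_denominator double_series_def swap_vars_X_power
    by (fastforce simp: embed_q_mult embed_q_X_power case_prod_unfold mult.assoc)
qed

lemma has_sum_shifted_double_series:
  "((\<lambda>(i, j). var_x ^ (i + 2 * j + 1) * var_q ^ (2 * i^2 + 6 * i * j + 6 * j^2 + u * i + v * j + 1)
      / (qpoch var_q var_q i * qpoch (var_q ^ 3) (var_q ^ 3) j))
    has_sum swap_vars (fps_X * (qconst * double_series u v))) UNIV"
proof -
  let ?e = "\<lambda>(i, j). 2 * i^2 + 6 * i * j + 6 * j^2 + u * i + v * j + 1"
  let ?c = "\<lambda>(i, j). fps_X ^ ?e (i, j) * (inv_qpoch 1 i * inv_qpoch 3 j)"
  have fin: "finite {p. (case p of (i, j) \<Rightarrow> i + 2 * j + 1) = n}" for n :: nat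
    by (rule finite_subset[of _ "{..n} \<times> {..n}"]) auto
  have fin': "finite {p. ?e p \<le> N}" for N
    by (rule finite_subset[OF _ finite_double_exponent[of u v N]]) auto
  \<comment> \<open>With the identity as reindexing map, \<open>sum_by_reindex\<close> pulls out the
    factor xq common to all terms.\<close>
  have "sum_by (\<lambda>(i, j). i + 2 * j + 1) ?c = fps_X ^ 1 * (fps_const fps_X * double_series u v)"
    unfolding double_series_def
    by (rule sum_by_reindex[where \<phi> = "\<lambda>p. p"]) (auto simp: mult.assoc intro: fin[simplified])
  then have eq: "sum_by (\<lambda>(i, j). i + 2 * j + 1) ?c = fps_X * (qconst * double_series u v)"
    by (simp only: power_one_right qconst_def)
  have "((\<lambda>p. swap_vars (fps_X ^ (case p of (i, j) \<Rightarrow> i + 2 * j + 1) * fps_const (?c p)))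
      has_sum swap_vars (sum_by (\<lambda>(i, j). i + 2 * j + 1) ?c)) UNIV"
    by (rule has_sum_sum_by[where e = ?e, OF fin fin']) (auto simp only: prod.case)
  then show ?thesis
    unfolding divide_double_denominator swap_vars_X_power eq
    by (simp only: embed_q_mult embed_q_X_power case_prod_unfold mult.assoc prod.sel)
qed

lemma has_sum_quadruple_series:
  "((\<lambda>(i, j, k, l). let R = i + j + k + 2 * l in
      var_x ^ R
        * var_q ^ (3 * R * (R - 1) div 2 + \<alpha> * i + \<beta> * j + 3 * j * (j - 1) div 2
               + \<gamma> * k + 3 * k * (k - 1) div 2 + \<delta> * l)
        / (qpoch (var_q ^ 3) (var_q ^ 3) i * qpoch (var_q ^ 3) (var_q ^ 3) j
           * qpoch (var_q ^ 3) (var_q ^ 3) k * qpoch (var_q ^ 6) (var_q ^ 6) l))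
    has_sum swap_vars (quadruple_series \<alpha> \<beta> \<gamma> \<delta>)) UNIV"
  if "\<alpha> > 0" "\<beta> > 0" "\<gamma> > 0" "\<delta> > 0"
proof -
  \<comment> \<open>One of n and n - 1 is even, so the integer division is exact; at n = 0 the
    truncated n - 1 is multiplied by 0.\<close>
  have tri: "3 * n * (n - 1) div 2 = 3 * (n choose 2)" for n :: nat
  proof -
    have "even (n * (n - 1))" by (cases n) simp_all
    then show ?thesis by (simp only: choose_two mult.assoc div_mult_swap)
  qed
  let ?e = "\<lambda>(i, j, k, l). 3 * ((i + j + k + 2 * l) choose 2) + \<alpha> * i
          + (\<beta> * j + 3 * (j choose 2)) + (\<gamma> * k + 3 * (k choose 2)) + \<delta> * l"
  let ?c = "\<lambda>(i, j, k, l). fps_X ^ ?e (i, j, k, l) * (inv_qpoch 3 i * inv_qpoch 3 j * inv_qpoch 3 k * inv_qpoch 6 l)"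
  have fin: "finite {p. ?e p \<le> N}" for N
  proof (rule finite_subset)
    show "{p. ?e p \<le> N} \<subseteq> {..N} \<times> {..N} \<times> {..N} \<times> {..N}"
    proof
      fix p assume p: "p \<in> {p. ?e p \<le> N}"
      obtain i j k l where eq: "p = (i, j, k, l)" by (cases p) auto
      \<comment> \<open>Positive parameters let the linear part of the exponent alone bound all four
        indices.\<close>
      have "i \<le> \<alpha> * i" "j \<le> \<beta> * j" "k \<le> \<gamma> * k" "l \<le> \<delta> * l"
        using that by simp_all
      with p show "p \<in> {..N} \<times> {..N} \<times> {..N} \<times> {..N}"
        unfolding eq mem_Collect_eq prod.case mem_Times_iff fst_conv snd_conv atMost_iff by linarith
    qed
  qed simp
  from has_sum_sum_by[where e = ?e, OF finite_quadruple_weight fin, of ?c]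
  show ?thesis
    unfolding divide_quadruple_denominator quadruple_series_def swap_vars_X_power Let_def tri
    by (fastforce simp: embed_q_mult embed_q_X_power case_prod_unfold mult.assoc add.assoc)
qed

theorem mainTheorem13:
  fixes x q :: "rat fps fps"
  assumes "x = var_x" and "q = var_q"
  shows
    "(\<exists>F.
       ((\<lambda>\<pi>. x ^ length \<pi> * q ^ sum_list \<pi>) has_sum F) P1 \<and>
       ((\<lambda>(i::nat, j::nat).
           x ^ (i + 2 * j) * q ^ (2 * i^2 + 6 * i * j + 6 * j^2)
             / (qpoch q q i * qpoch (q^3) (q^3) j)) has_sum F) UNIV)
     \<and>
     (\<exists>G A B.
       ((\<lambda>\<pi>. x ^ length \<pi> * q ^ sum_list \<pi>) has_sum G) P2 \<and>
       ((\<lambda>(i::nat, j::nat, k::nat, l::nat).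
           let R = i + j + k + 2 * l in
           x ^ R
             * q ^ (3 * R * (R - 1) div 2 + 3 * i + 5 * j + 3 * j * (j - 1) div 2
                    + k + 3 * k * (k - 1) div 2 + 3 * l)
             / (qpoch (q^3) (q^3) i * qpoch (q^3) (q^3) j
                * qpoch (q^3) (q^3) k * qpoch (q^6) (q^6) l)) has_sum G) UNIV \<and>
       ((\<lambda>(i::nat, j::nat).
           x ^ (i + 2 * j) * q ^ (2 * i^2 + 6 * i * j + 6 * j^2 + i)
             / (qpoch q q i * qpoch (q^3) (q^3) j)) has_sum A) UNIV \<and>
       ((\<lambda>(i::nat, j::nat).
           x ^ (i + 2 * j + 1) * q ^ (2 * i^2 + 6 * i * j + 6 * j^2 + 4 * i + 6 * j + 1)
             / (qpoch q q i * qpoch (q^3) (q^3) j)) has_sum B) UNIV \<and>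
       G = A + B)"
  unfolding assms
proof (intro conjI exI)
  have partitions: "P1 \<subseteq> partitions" "P2 \<subseteq> partitions"
    by (auto simp: P1_def P2_def C_parts_def)
  let ?F = "swap_vars (double_series 0 0)"
    and ?G = "swap_vars (quadruple_series 3 5 1 3)"
    and ?A = "swap_vars (double_series 1 0)"
    and ?B = "swap_vars (fps_X * (qconst * double_series 4 6))"
  show "((\<lambda>\<pi>. var_x ^ length \<pi> * var_q ^ sum_list \<pi>) has_sum ?F) P1"
    using has_sum_count_series[OF partitions(1)]
    by (simp only: P1_eq double_series_solution)
  show "((\<lambda>(i, j). var_x ^ (i + 2 * j) * var_q ^ (2 * i^2 + 6 * i * j + 6 * j^2)
             / (qpoch var_q var_q i * qpoch (var_q^3) (var_q^3) j)) has_sum ?F) UNIV"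
    using has_sum_double_series[of 0 0] by (simp only: mult_0 add_0_right)
  show "((\<lambda>\<pi>. var_x ^ length \<pi> * var_q ^ sum_list \<pi>) has_sum ?G) P2"
    using has_sum_count_series[OF partitions(2)]
    by (simp only: count_series_P2_quadruple)
  show "((\<lambda>(i, j, k, l).
           let R = i + j + k + 2 * l in
           var_x ^ R
             * var_q ^ (3 * R * (R - 1) div 2 + 3 * i + 5 * j + 3 * j * (j - 1) div 2
                    + k + 3 * k * (k - 1) div 2 + 3 * l)
             / (qpoch (var_q^3) (var_q^3) i * qpoch (var_q^3) (var_q^3) j
                * qpoch (var_q^3) (var_q^3) k * qpoch (var_q^6) (var_q^6) l)) has_sum ?G) UNIV"
    using has_sum_quadruple_series[of 3 5 1 3]
    by (simp only: mult_1_left zero_less_numeral zero_less_one simp_thms)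
  show "((\<lambda>(i, j). var_x ^ (i + 2 * j) * var_q ^ (2 * i^2 + 6 * i * j + 6 * j^2 + i)
             / (qpoch var_q var_q i * qpoch (var_q^3) (var_q^3) j)) has_sum ?A) UNIV"
    using has_sum_double_series[of 1 0] by (simp only: mult_0 mult_1_left add_0_right)
  show "((\<lambda>(i, j). var_x ^ (i + 2 * j + 1)
             * var_q ^ (2 * i^2 + 6 * i * j + 6 * j^2 + 4 * i + 6 * j + 1)
             / (qpoch var_q var_q i * qpoch (var_q^3) (var_q^3) j)) has_sum ?B) UNIV"
    by (rule has_sum_shifted_double_series)
  \<comment> \<open>Both sides are the generating function of \<open>P2\<close> with the variables
    exchanged.\<close>
  show "?G = ?A + ?B"
    by (simp only: count_series_P2_double flip: count_series_P2_quadruple swap_vars_add)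
qed

end
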